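(* Let $k_1 \ge k_2 \ge 2$ be integers. Then every digraph $D$ with $\delta^+(D) \ge k_1 + 3k_2 - 5$ contains a subdivision of $C(k_1,k_2)$; that is, $\mathrm{mader}_{\delta^+}(C(k_1,k_2)) \le k_1+3k_2-5$.
   Context: Digraphs are finite, loopless, have no parallel arcs, but may contain digons. $C(k_1,k_2)$ denotes the oriented cycle consisting of two vertices $x,y$ and two internally vertex-disjoint directed paths from $x$ to $y$ of lengths $k_1$ and $k_2$. A subdivision of a digraph $F$ is obtained by replacing each arc $(u,v)$ of $F$ by a directed $u$-$v$-path, with paths for different arcs internally vertex-disjoint. $\mathrm{mader}_{\delta^+}(F)$ is the smallest integer $m$ such that every digraph of minimum out-degree at least $m$ contains a subdivision of $F$. *)

theory Defs
  imports Main
begin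

text \<open>A digraph is a pair (V, A): a finite nonempty vertex set V and an arc set
A \<subseteq> V \<times> V without loops. Parallel arcs are impossible (A is a set);
digons (both (u,v) and (v,u)) are allowed.\<close>

definition digraph :: "'a set \<Rightarrow> ('a \<times> 'a) set \<Rightarrow> bool" where
  "digraph V A \<longleftrightarrow> finite V \<and> V \<noteq> {} \<and> A \<subseteq> V \<times> V \<and> (\<forall>v. (v, v) \<notin> A)"

definition out_nbrs :: "('a \<times> 'a) set \<Rightarrow> 'a \<Rightarrow> 'a set" where
  "out_nbrs A v = {w. (v, w) \<in> A}"

definition min_outdeg_ge :: "'a set \<Rightarrow> ('a \<times> 'a) set \<Rightarrow> nat \<Rightarrow> bool" where
  "min_outdeg_ge V A m \<longleftrightarrow> (\<forall>v\<in>V. card (out_nbrs A v) \<ge> m)"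

definition dipath :: "'a set \<Rightarrow> ('a \<times> 'a) set \<Rightarrow> 'a \<Rightarrow> 'a \<Rightarrow> 'a list \<Rightarrow> bool" where
  "dipath V A u v p \<longleftrightarrow> length p \<ge> 2 \<and> distinct p \<and> set p \<subseteq> V \<and>
     hd p = u \<and> last p = v \<and> (\<forall>i. Suc i < length p \<longrightarrow> (p ! i, p ! Suc i) \<in> A)"

definition inner :: "'a list \<Rightarrow> 'a set" where
  "inner p = set (butlast (tl p))"

definition contains_subdivision ::
  "'a set \<Rightarrow> ('a \<times> 'a) set \<Rightarrow> 'b set \<Rightarrow> ('b \<times> 'b) set \<Rightarrow> bool" where
  "contains_subdivision V A VF AF \<longleftrightarrow>
    (\<exists>(f :: 'b \<Rightarrow> 'a) (P :: 'b \<times> 'b \<Rightarrow> 'a list).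
       inj_on f VF \<and> f ` VF \<subseteq> V \<and>
       (\<forall>(a, b)\<in>AF. dipath V A (f a) (f b) (P (a, b)) \<and> inner (P (a, b)) \<inter> f ` VF = {}) \<and>
       (\<forall>e\<in>AF. \<forall>e'\<in>AF. e \<noteq> e' \<longrightarrow> inner (P e) \<inter> set (P e') = {}))"

text \<open>The oriented cycle C(k1,k2) on natural-number vertices: x = 0, y = 1,
first path 0, 2, 3, ..., k1, 1 (length k1), second path
0, k1+1, ..., k1+k2-1, 1 (length k2).\<close>
definition Cpath1 :: "nat \<Rightarrow> nat \<Rightarrow> nat list" where
  "Cpath1 k1 k2 = [0] @ [2..<k1+1] @ [1]"

definition Cpath2 :: "nat \<Rightarrow> nat \<Rightarrow> nat list" where
  "Cpath2 k1 k2 = [0] @ [k1+1..<k1+k2] @ [1]"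

definition C_verts :: "nat \<Rightarrow> nat \<Rightarrow> nat set" where
  "C_verts k1 k2 = set (Cpath1 k1 k2) \<union> set (Cpath2 k1 k2)"

definition C_arcs :: "nat \<Rightarrow> nat \<Rightarrow> (nat \<times> nat) set" where
  "C_arcs k1 k2 = set (zip (Cpath1 k1 k2) (tl (Cpath1 k1 k2)))
                 \<union> set (zip (Cpath2 k1 k2) (tl (Cpath2 k1 k2)))"

end

theory Submission
  imports Defs
begin

text \<open>
  Write \<open>a = k1\<close>, \<open>b = k2\<close>; minimum out-degree \<open>a + 2 b - 3\<close>, which is at most \<open>a + 3 b - 5\<close>, already
  suffices. Take a path \<open>p 0, \<dots>, p n\<close> all of whose end vertex's out-neighbours lie on
  \<open>p i, \<dots>, p n\<close>, with \<open>i\<close> maximal and then \<open>n\<close> maximal; so \<open>p n \<rightarrow> p i\<close>. A detour consists of a path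
  of length \<open>b - 1\<close> that leaves \<open>p m\<close>, runs up the spine and then possibly off it, and ends with an arc
  back to some \<open>p s\<close>, \<open>s < m\<close>, where \<open>s - i \<ge> a - 2\<close>. Extend \<open>p m\<close> by a maximal path \<open>W\<close> avoiding the
  spine and the detour, with end \<open>w\<close>. An arc from \<open>w\<close> to the spine far below \<open>p s\<close>, or above the
  detour, gives two paths from \<open>p m\<close> to \<open>p s\<close>; in the latter case one of them goes around through
  \<open>p n \<rightarrow> p i\<close>. Hence if \<open>W\<close> is short, the out-degree of \<open>w\<close> forces an arc back to the spine close
  to \<open>p s\<close> or above it, and \<open>W\<close> yields a detour with smaller \<open>m\<close>. If \<open>W\<close> is long, an arc
  from \<open>w\<close> into the off-spine part of the detour gives two paths again, an arc forward to the spine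
  contradicts the maximality of \<open>n\<close>, and otherwise the maximality of \<open>i\<close> is violated.
  So \<open>m\<close> decreases forever.
\<close>

section \<open>Paths as lists\<close>

definition simple_path :: "'a set \<Rightarrow> ('a \<times> 'a) set \<Rightarrow> 'a list \<Rightarrow> bool" where
  "simple_path V A xs \<longleftrightarrow> distinct xs \<and> set xs \<subseteq> V \<and> successively (\<lambda>u v. (u, v) \<in> A) xs"

lemma simple_path_Nil [simp]: "simple_path V A []"
  by (simp add: simple_path_def)

lemma simple_path_append:
  "simple_path V A (xs @ ys) \<longleftrightarrow> simple_path V A xs \<and> simple_path V A ys \<and> set xs \<inter> set ys = {} \<and>
     (xs = [] \<or> ys = [] \<or> (last xs, hd ys) \<in> A)"
  by (auto simp: simple_path_def successively_append_iff)

lemma simple_path_Cons: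
  "simple_path V A (x # ys) \<longleftrightarrow> x \<in> V \<and> x \<notin> set ys \<and> simple_path V A ys \<and> (ys = [] \<or> (x, hd ys) \<in> A)"
  by (auto simp: simple_path_def successively_Cons)

lemma simple_path_imp_dipath:
  assumes "simple_path V A xs" "2 \<le> length xs" "hd xs = u" "last xs = v"
  shows "dipath V A u v xs"
  using assms by (auto simp: simple_path_def dipath_def successively_conv_nth)

lemma length_simple_path_le:
  assumes "finite V" "simple_path V A xs"
  shows "length xs \<le> card V"
  using assms card_mono distinct_card unfolding simple_path_def by metis

text \<open>Simple paths have at most \<open>card V\<close> vertices, so there is a longest
  extension avoiding \<open>X\<close>; an out-neighbour of its end outside the path and
  \<open>X\<close> could be appended to it.\<close>

lemma maximal_extension:
  assumes "finite V" "A \<subseteq> V \<times> V" "simple_path V A xs" "xs \<noteq> []"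
  obtains W where "simple_path V A (xs @ W)" "set W \<inter> X = {}"
    "out_nbrs A (last (xs @ W)) \<subseteq> set (xs @ W) \<union> X"
proof -
  let ?P = "\<lambda>W. simple_path V A (xs @ W) \<and> set W \<inter> X = {}"
  have "?P []"
    using assms by simp
  moreover have "\<forall>W. ?P W \<longrightarrow> length W \<le> card V"
    using length_simple_path_le[OF assms(1)] by (metis length_append le_add2 order_trans)
  ultimately obtain W where W: "?P W" and longest: "\<And>W'. ?P W' \<Longrightarrow> length W' \<le> length W"
    using ex_has_greatest_nat[of ?P "[]" length "Suc (card V)"] by (auto simp: less_Suc_eq_le)
  have "out_nbrs A (last (xs @ W)) \<subseteq> set (xs @ W) \<union> X"
  proof
    fix y assume y: "y \<in> out_nbrs A (last (xs @ W))"
    show "y \<in> set (xs @ W) \<union> X"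
    proof (rule ccontr)
      assume n: "y \<notin> set (xs @ W) \<union> X"
      have "simple_path V A ((xs @ W) @ [y])"
        using W y n assms by (subst simple_path_append) (auto simp: simple_path_Cons out_nbrs_def)
      then have "?P (W @ [y])" using W n by auto
      from longest[OF this] show False by simp
    qed
  qed
  with W that show thesis by blast
qed

text \<open>The shape of later disjointness checks: \<open>N\<close> is the spine, \<open>I\<close>
  and \<open>J\<close> are parts of it, \<open>W\<close> and \<open>Q\<close> leave it.\<close>

lemma disjoint_unions:
  "W \<inter> (N \<union> Q) = {} \<Longrightarrow> Q \<inter> N = {} \<Longrightarrow> I \<subseteq> N \<Longrightarrow> J \<subseteq> N \<Longrightarrow> I \<inter> J = {} \<Longrightarrow> (W \<union> I) \<inter> (J \<union> Q) = {}"
  by blast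

section \<open>Two internally disjoint paths\<close>

text \<open>\<open>X\<close> and \<open>Y\<close> are the interiors. Lower bounds on the lengths
  suffice, since subdividing may lengthen any arc.\<close>

definition has_two_paths :: "'a set \<Rightarrow> ('a \<times> 'a) set \<Rightarrow> nat \<Rightarrow> nat \<Rightarrow> bool" where
  "has_two_paths V A a b \<longleftrightarrow> (\<exists>x y X Y. simple_path V A (x # X @ [y]) \<and> simple_path V A (x # Y @ [y]) \<and>
     set X \<inter> set Y = {} \<and> a \<le> Suc (length X) \<and> b \<le> Suc (length Y))"

lemma has_two_pathsI:
  assumes "simple_path V A (x # X @ [y])" "simple_path V A (x # Y @ [y])" "set X \<inter> set Y = {}"
    "a \<le> Suc (length X)" "b \<le> Suc (length Y)"
  shows "has_two_paths V A a b"
  using assms unfolding has_two_paths_def by blast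

section \<open>Extremal paths\<close>

definition lollipop :: "'a set \<Rightarrow> ('a \<times> 'a) set \<Rightarrow> nat \<Rightarrow> 'a list \<Rightarrow> bool" where
  "lollipop V A i xs \<longleftrightarrow> simple_path V A xs \<and> xs \<noteq> [] \<and> out_nbrs A (last xs) \<subseteq> set (drop i xs)"

text \<open>The setting of a proof by contradiction, closed by \<open>inconsistent\<close>.
  \<open>max_n\<close> compares only paths with the same \<open>i\<close>, because \<open>n\<close>
  is maximised after \<open>i\<close>.\<close>

locale extremal_lollipop =
  fixes V :: "'a set" and A :: "('a \<times> 'a) set" and a b :: nat and p :: "nat \<Rightarrow> 'a" and n i :: nat
  assumes fin: "finite V" and arcs: "A \<subseteq> V \<times> V" and noloop: "(v, v) \<notin> A"
    and ab: "b \<le> a" "2 \<le> b"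
    and outdeg: "v \<in> V \<Longrightarrow> a + 2 * b - 3 \<le> card (out_nbrs A v)"
    and inj: "inj_on p {..n}" and pV: "k \<le> n \<Longrightarrow> p k \<in> V"
    and parc: "k < n \<Longrightarrow> (p k, p (Suc k)) \<in> A"
    and i_le: "i \<le> n" and back_arc: "(p n, p i) \<in> A" and last_nbrs: "out_nbrs A (p n) \<subseteq> p ` {i..n}"
    and max_i: "lollipop V A j xs \<Longrightarrow> j \<le> i"
    and max_n: "lollipop V A i xs \<Longrightarrow> length xs \<le> Suc n"
    and no_two_paths: "\<not> has_two_paths V A a b"
begin

abbreviation seg :: "nat \<Rightarrow> nat \<Rightarrow> 'a list" where
  "seg j k \<equiv> map p [j..<k]"

lemma p_eq_iff: "j \<le> n \<Longrightarrow> k \<le> n \<Longrightarrow> p j = p k \<longleftrightarrow> j = k"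
  using inj by (auto simp: inj_on_def)

lemma simple_path_seg: "k \<le> Suc n \<Longrightarrow> simple_path V A (seg j k)"
  unfolding simple_path_def using pV parc
  by (auto simp: distinct_map successively_conv_nth intro!: inj_on_subset[OF inj])

lemma last_seg: "j < k \<Longrightarrow> last (seg j k) = p (k - 1)"
  by (simp add: last_map)

lemma hd_seg: "j < k \<Longrightarrow> hd (seg j k) = p j"
  by (simp add: hd_map)

text \<open>The path runs up to \<open>p n\<close>, takes the arc to \<open>p i\<close> and climbs
  again to \<open>p s\<close>; it stays simple because it stops below \<open>p l\<close>.\<close>

lemma simple_path_around:
  assumes "i \<le> s" "s < l" "l \<le> n"
  shows "simple_path V A (seg l (Suc n) @ seg i (Suc s))"
  using assms back_arc
  by (auto simp: simple_path_append simple_path_seg last_seg hd_seg p_eq_iff simp del: upt_Suc)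

text \<open>The final conjunct keeps \<open>s\<close> above an out-neighbour \<open>p s0\<close> of \<open>p n\<close>, a possible sink of the two paths
  for every later \<open>m\<close>.\<close>
definition detour :: "nat \<Rightarrow> nat \<Rightarrow> 'a list \<Rightarrow> nat \<Rightarrow> bool" where
  "detour m M Q s \<longleftrightarrow> m \<le> M \<and> M \<le> n \<and> m + b \<le> Suc n \<and> s < m \<and>
     simple_path V A (seg m (Suc M) @ Q) \<and> set Q \<inter> p ` {..n} = {} \<and>
     M - m + length Q = b - 1 \<and> (last (seg m (Suc M) @ Q), p s) \<in> A \<and>
     (\<exists>s0\<le>s. (p n, p s0) \<in> A \<and> i + a \<le> s0 + 2)"

section \<open>Pairs of paths obtained from a detour\<close>

lemma detour_Cons:
  assumes "detour m M Q s"
  obtains T where "seg m (Suc M) @ Q = p m # T" "T = seg (Suc m) (Suc M) @ Q" "length T = b - 1"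
    "set T = p ` {m<..M} \<union> set Q" "simple_path V A (p m # T)" "simple_path V A (p m # T @ [p s])"
    "(last (p m # T), p s) \<in> A"
proof
  let ?T = "seg (Suc m) (Suc M) @ Q"
  have d: "m \<le> M" "M \<le> n" "s < m" "simple_path V A (seg m (Suc M) @ Q)" "set Q \<inter> p ` {..n} = {}"
     "M - m + length Q = b - 1" "(last (seg m (Suc M) @ Q), p s) \<in> A"
    using assms by (auto simp: detour_def)
  show e: "seg m (Suc M) @ Q = p m # ?T"
    using d by (simp add: upt_conv_Cons del: upt_Suc)
  show "?T = ?T" ..
  show "length ?T = b - 1" using d by (simp del: upt_Suc)
  show set: "set ?T = p ` {m<..M} \<union> set Q" by (auto simp del: upt_Suc)
  show p: "simple_path V A (p m # ?T)" using d e by metis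
  show l: "(last (p m # ?T), p s) \<in> A" using d e by metis
  have "p s \<notin> set (p m # ?T)"
    using d by (auto simp: set p_eq_iff simp del: upt_Suc)
  then have "simple_path V A ((p m # ?T) @ [p s])"
    using p l pV[of s] d by (subst simple_path_append) (auto simp: simple_path_Cons simp del: upt_Suc)
  then show "simple_path V A (p m # ?T @ [p s])" by simp
qed

text \<open>Otherwise \<open>W\<close>, the arc to \<open>p j\<close> and the spine up to
  \<open>p s\<close> form a path of length at least \<open>a\<close>. The detour closed by its arc
  to \<open>p s\<close> has length \<open>b\<close>, and it meets the spine below \<open>m\<close>
  only in \<open>p s\<close>.\<close>

lemma detour_no_back_jump:
  assumes "detour m M Q s" "simple_path V A (p m # W)" "set W \<inter> (p ` {..n} \<union> set Q) = {}"
    "(last (p m # W), p j) \<in> A" "j \<le> s"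
  shows "Suc (length W) + (s - j) < a"
proof (rule ccontr)
  assume long: "\<not> Suc (length W) + (s - j) < a"
  obtain T where T: "length T = b - 1" "set T = p ` {m<..M} \<union> set Q" "simple_path V A (p m # T @ [p s])"
    using assms(1) by (rule detour_Cons)
  have b: "M \<le> n" "s < m" "m \<le> M" "set Q \<inter> p ` {..n} = {}" using assms(1) by (auto simp: detour_def)
  have "simple_path V A ((p m # W) @ seg j (Suc s))"
    using assms b
    by (subst simple_path_append) (auto simp: simple_path_seg hd_seg p_eq_iff simp del: upt_Suc)
  then have 1: "simple_path V A (p m # (W @ seg j s) @ [p s])"
    using \<open>j \<le> s\<close> by simp
  have "p ` {j..<s} \<inter> p ` {m<..M} = {}" using b by (auto simp: p_eq_iff)
  moreover have "p ` {j..<s} \<subseteq> p ` {..n}" "p ` {m<..M} \<subseteq> p ` {..n}" using b by auto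
  ultimately have "(set W \<union> p ` {j..<s}) \<inter> set T = {}"
    unfolding T(2) by (intro disjoint_unions[OF assms(3) b(4)])
  then have "set (W @ seg j s) \<inter> set T = {}"
    by simp
  then have "has_two_paths V A a b"
    using has_two_pathsI[OF 1 T(3)] T(1) long ab by simp
  then show False using no_two_paths by simp
qed

text \<open>Landing above the detour allows going around to \<open>p s\<close>. The arcs into
  \<open>p l\<close> and \<open>p i\<close> and the \<open>s - i \<ge> a - 2\<close> arcs from
  \<open>p i\<close> to \<open>p s\<close> already give length \<open>a\<close>.\<close>

lemma detour_no_forward_jump:
  assumes "detour m M Q s" "simple_path V A (p m # W)" "set W \<inter> (p ` {..n} \<union> set Q) = {}"
    "(last (p m # W), p l) \<in> A" "l \<le> n"
  shows "l \<le> M"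
proof (rule ccontr)
  assume l: "\<not> l \<le> M"
  obtain T where T: "length T = b - 1" "set T = p ` {m<..M} \<union> set Q" "simple_path V A (p m # T @ [p s])"
    using assms(1) by (rule detour_Cons)
  have b: "M \<le> n" "s < m" "m \<le> M" "set Q \<inter> p ` {..n} = {}" "i + a \<le> s + 2"
    using assms(1) by (auto simp: detour_def)
  then have ile: "i \<le> s" using ab by simp
  have "simple_path V A ((p m # W) @ seg l (Suc n) @ seg i (Suc s))"
    using assms b l simple_path_around[of s l] ile
    by (subst simple_path_append) (auto simp: hd_seg p_eq_iff simp del: upt_Suc)
  then have 1: "simple_path V A (p m # (W @ seg l (Suc n) @ seg i s) @ [p s])"
    using ile by simp
  have "p ` ({l..n} \<union> {i..<s}) \<inter> p ` {m<..M} = {}" using b l by (auto simp: p_eq_iff)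
  moreover have "p ` ({l..n} \<union> {i..<s}) \<subseteq> p ` {..n}" "p ` {m<..M} \<subseteq> p ` {..n}" using b l assms by auto
  moreover have "set (W @ seg l (Suc n) @ seg i s) = set W \<union> p ` ({l..n} \<union> {i..<s})"
    by (auto simp del: upt_Suc)
  ultimately have "set (W @ seg l (Suc n) @ seg i s) \<inter> set T = {}"
    unfolding T(2) using disjoint_unions[OF assms(3) b(4)] by metis
  then have "has_two_paths V A a b"
    using has_two_pathsI[OF 1 T(3)] T(1) b l ab assms(5) by simp
  then show False using no_two_paths by simp
qed

text \<open>The first path now follows the whole upper spine and goes around to \<open>p s\<close>.
  The second takes \<open>W\<close>, then \<open>Q\<close> from \<open>z\<close> on, and has no
  inner vertex on the spine.\<close>

lemma detour_no_long_return:
  assumes "detour m M Q s" "simple_path V A (p m # W)" "set W \<inter> (p ` {..n} \<union> set Q) = {}"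
    "z \<in> set Q" "(last (p m # W), z) \<in> A"
  shows "length W < b - 1"
proof (rule ccontr)
  assume long: "\<not> length W < b - 1"
  obtain T where T: "T = seg (Suc m) (Suc M) @ Q" "simple_path V A (p m # T)" "(last (p m # T), p s) \<in> A"
    using assms(1) by (rule detour_Cons)
  obtain Q1 Q2 where Q: "Q = Q1 @ z # Q2" using assms(4) by (auto simp: in_set_conv_decomp)
  have b: "M \<le> n" "s < m" "m \<le> M" "set Q \<inter> p ` {..n} = {}" "i + a \<le> s + 2" "m + b \<le> Suc n"
    using assms(1) by (auto simp: detour_def)
  then have ile: "i \<le> s" and mn: "m < n" using ab by simp_all
  have "simple_path V A ((p m # seg (Suc m) (Suc M) @ Q1) @ z # Q2)"
    using T Q by (simp del: upt_Suc)
  then have zQ: "simple_path V A (z # Q2)" "p m \<notin> set (z # Q2)"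
    by (subst (asm) simple_path_append, auto)+
  have lastQ: "(last (z # Q2), p s) \<in> A" using T Q by (simp split: if_splits)
  have ps: "p s \<notin> set (z # Q2)" "p s \<noteq> p m" "p s \<notin> set W" using b Q assms(3) by (auto simp: p_eq_iff)
  have "simple_path V A ((p m # W) @ (z # Q2) @ [p s])"
    using assms(2,3,5) zQ Q pV[of s] b ps lastQ
    by (subst simple_path_append, subst simple_path_append) (auto simp: simple_path_Cons)
  then have 2: "simple_path V A (p m # (W @ z # Q2) @ [p s])" by simp
  have "simple_path V A (seg m (Suc n) @ seg i (Suc s))"
    using simple_path_around[of s m] ile b by simp
  then have 1: "simple_path V A (p m # (seg (Suc m) (Suc n) @ seg i s) @ [p s])"
    using ile mn by (simp add: upt_conv_Cons)
  have "set (seg (Suc m) (Suc n) @ seg i s) \<subseteq> p ` {..n}" using b by auto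
  moreover have "set (W @ z # Q2) \<subseteq> set W \<union> set Q" using Q by auto
  moreover have "(set W \<union> set Q) \<inter> p ` {..n} = {}"
    using assms(3) b(4) by (simp only: Int_Un_distrib Int_Un_distrib2) simp
  ultimately have "set (seg (Suc m) (Suc n) @ seg i s) \<inter> set (W @ z # Q2) = {}"
    by (meson disjoint_iff subset_iff)
  then have "has_two_paths V A a b"
    using has_two_pathsI[OF 1 2] b ab mn long by simp
  then show False using no_two_paths by simp
qed

text \<open>
  Replacing the spine between \<open>p m\<close> and \<open>p l\<close> by \<open>W\<close> and extending it maximally gives a longer path.
  By the choice of \<open>n\<close> its end has an arc to below \<open>p i\<close>, and the skipped vertices together with
  the extension lead from \<open>p m\<close> to that end.
\<close>
lemma no_long_bypass:
  assumes W: "simple_path V A (p m # W)" "set W \<inter> p ` {..n} = {}" "(last (p m # W), p l) \<in> A"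
    and l: "m < l" "l \<le> n" "l - m \<le> length W"
    and s: "(p n, p s) \<in> A" "i + a \<le> s + 2" "s < m" and m: "m + b \<le> Suc n"
  shows False
proof -
  have ile: "i \<le> s" using s ab by simp
  let ?B = "(seg 0 m @ p m # W) @ seg l (Suc n)"
  have B1: "simple_path V A (seg 0 m @ p m # W)"
    using W s l m simple_path_seg[of "Suc m" 0]
    by (subst simple_path_append) (auto simp: simple_path_append simple_path_Cons)
  have pW: "p k \<notin> set W" if "k \<le> n" for k using W(2) that by auto
  have B: "simple_path V A ?B"
    using B1 W l
    by (subst simple_path_append) (auto simp: simple_path_seg hd_seg p_eq_iff pW simp del: upt_Suc)
  have setB: "set ?B = p ` ({..m} \<union> {l..n}) \<union> set W"
    by (auto simp del: upt_Suc simp: le_less)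
  have lastB: "last ?B = p n" using l by (simp add: last_seg)
  obtain E where E: "simple_path V A (?B @ E)" "out_nbrs A (last (?B @ E)) \<subseteq> set (?B @ E)"
    using maximal_extension[OF fin arcs B, of "{}"] by auto
  let ?e = "last (?B @ E)"
  \<comment> \<open>The \<open>l - m - 1\<close> skipped vertices are replaced by at least
    \<open>l - m\<close> vertices of \<open>W\<close>.\<close>
  have longer: "Suc n < length (?B @ E)" using l by simp
  have takeB: "set (take i (?B @ E)) = p ` {..<i}"
  proof -
    have "take i (?B @ E) = seg 0 i"
      using ile s by (simp add: take_map)
    then show ?thesis by (simp add: atLeast0LessThan)
  qed
  \<comment> \<open>All out-neighbours of the end lie on the path, so one of them is among its first
    \<open>i\<close> vertices; these are unchanged because \<open>i \<le> s < m\<close>.\<close>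
  have "\<not> lollipop V A i (?B @ E)"
    using longer max_n by fastforce
  then obtain y where y: "y \<in> out_nbrs A ?e" "y \<notin> set (drop i (?B @ E))"
    using E by (auto simp: lollipop_def)
  have "set (?B @ E) = set (take i (?B @ E)) \<union> set (drop i (?B @ E))"
    by (metis append_take_drop_id set_append)
  then have "y \<in> p ` {..<i}"
    using y E(2) takeB by blast
  then obtain j where j: "j < i" "(?e, p j) \<in> A"
    using y(1) unfolding out_nbrs_def by blast
  have "E \<noteq> []"
  proof
    assume "E = []"
    then have "p j \<in> p ` {i..n}" using j lastB last_nbrs by (auto simp: out_nbrs_def)
    then show False using j i_le by (auto simp: p_eq_iff)
  qed
  have "simple_path V A E" and EB: "set ?B \<inter> set E = {}" and "(last ?B, hd E) \<in> A"
    using E(1) \<open>E \<noteq> []\<close> by (auto simp only: simple_path_append)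
  \<comment> \<open>\<open>E\<close> starts at an out-neighbour of \<open>p n\<close>, hence on the
    spine, where only the skipped vertices are still free.\<close>
  then obtain k where k: "hd E = p k" "k \<le> n" using lastB last_nbrs by (auto simp: out_nbrs_def)
  have "hd E \<notin> p ` ({..m} \<union> {l..n})"
    using EB \<open>E \<noteq> []\<close> setB by (metis UnCI disjoint_iff hd_in_set)
  then have "k \<notin> {..m} \<union> {l..n}" using k by blast
  then have "hd E \<in> p ` {m<..<l}" using k by auto
  then have "\<exists>x\<in>set E. x \<in> p ` {m<..<l}"
    using \<open>E \<noteq> []\<close> by (meson hd_in_set)
  \<comment> \<open>\<open>z\<close> is the last skipped vertex on \<open>E\<close>, so that
    \<open>E2\<close> avoids the spine.\<close>
  then obtain E1 z E2 where E12: "E = E1 @ z # E2" "z \<in> p ` {m<..<l}" "\<forall>x\<in>set E2. x \<notin> p ` {m<..<l}"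
    by (rule split_list_last_propE)
  then obtain r where r: "m < r" "r < l" "z = p r" by auto
  have zE: "simple_path V A (z # E2)" using \<open>simple_path V A E\<close> E12(1) by (simp add: simple_path_append)
  have laste: "last (p r # E2) = ?e" using E12 r by simp
  have E2n: "set E2 \<inter> p ` {..n} = {}"
  proof -
    have "{..n} = ({..m} \<union> {l..n}) \<union> {m<..<l}" using l by auto
    then have "p ` {..n} = p ` ({..m} \<union> {l..n}) \<union> p ` {m<..<l}" by (metis image_Un)
    moreover have "(p ` ({..m} \<union> {l..n}) \<union> set W) \<inter> set E2 = {}"
      using EB E12(1) unfolding setB by auto
    ultimately show ?thesis using E12(3) by blast
  qed
  have E2p: "p k \<notin> set E2" if "k \<le> n" for k using E2n that by auto
  have "simple_path V A (seg m (Suc r) @ E2)"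
    using zE r l simple_path_seg[of "Suc r" m]
    by (subst simple_path_append) (auto simp: last_seg E2p simple_path_Cons simp del: upt_Suc)
  moreover have "last (seg m (Suc r) @ E2) = ?e"
    using laste r by (auto simp: last_seg)
  ultimately have "simple_path V A ((seg m (Suc r) @ E2) @ seg j (Suc s))"
    using j r l s ile
    by (subst simple_path_append) (auto simp: simple_path_seg hd_seg E2p p_eq_iff simp del: upt_Suc)
  \<comment> \<open>Since \<open>j < i\<close>, the stretch from \<open>p j\<close> to
    \<open>p s\<close> alone has at least \<open>a - 1\<close> arcs.\<close>
  then have 1: "simple_path V A (p m # (seg (Suc m) (Suc r) @ E2 @ seg j s) @ [p s])"
    using r j ile by (simp add: upt_conv_Cons)
  \<comment> \<open>The second path uses the bypass and the arc from \<open>p n\<close> to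
    \<open>p s\<close>; it is longer than \<open>n - m\<close>, hence has length at least
    \<open>b\<close>.\<close>
  have "simple_path V A ((p m # W) @ seg l (Suc n) @ [p s])"
    using W s l pV[of s]
    by (subst simple_path_append, subst simple_path_append)
      (auto simp: simple_path_seg last_seg hd_seg p_eq_iff pW simple_path_Cons simp del: upt_Suc)
  then have 2: "simple_path V A (p m # (W @ seg l (Suc n)) @ [p s])"
    by simp
  have "set E2 \<inter> set W = {}" using EB setB E12 by auto
  then have "set (seg (Suc m) (Suc r) @ E2 @ seg j s) \<inter> set (W @ seg l (Suc n)) = {}"
    using r l s j by (auto simp: E2p pW p_eq_iff simp del: upt_Suc)
  then have "has_two_paths V A a b"
    using has_two_pathsI[OF 1 2] r l s j m by simp
  then show False using no_two_paths by simp
qed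

section \<open>Descent on detours\<close>

lemma detour_step:
  assumes D: "detour m M Q s"
  shows "\<exists>m' M' Q' s'. m' < m \<and> detour m' M' Q' s'"
proof -
  obtain T where T: "length T = b - 1" "set T = p ` {m<..M} \<union> set Q" "simple_path V A (p m # T)"
    using D by (rule detour_Cons)
  have d: "m \<le> M" "M \<le> n" "m + b \<le> Suc n" "s < m" "set Q \<inter> p ` {..n} = {}" "i + a \<le> s + 2"
     "M - m + length Q = b - 1"
    using D by (auto simp: detour_def)
  obtain s0 where s0: "s0 \<le> s" "(p n, p s0) \<in> A" "i + a \<le> s0 + 2"
    using D by (auto simp: detour_def)
  have "simple_path V A [p m]" using pV[of m] d by (simp add: simple_path_Cons)
  then obtain W where "simple_path V A ([p m] @ W)" "set W \<inter> (p ` {..n} \<union> set Q) = {}"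
     "out_nbrs A (last ([p m] @ W)) \<subseteq> set ([p m] @ W) \<union> (p ` {..n} \<union> set Q)"
    by (rule maximal_extension[OF fin arcs, of _ "p ` {..n} \<union> set Q"]) auto
  then have W: "simple_path V A (p m # W)" "set W \<inter> (p ` {..n} \<union> set Q) = {}"
     "out_nbrs A (last (p m # W)) \<subseteq> set W \<union> p ` {..n} \<union> set Q"
    using d by auto
  define w where "w = last (p m # W)"
  define q where "q = length W"
  have wV: "w \<in> V" using W(1) unfolding w_def simple_path_def by (metis last_in_set list.discI subsetD)
  have back_jump: "Suc q + (s - j) < a" if "(w, p j) \<in> A" "j \<le> s" for j
    using detour_no_back_jump[OF D W(1,2)] that by (simp add: w_def q_def)
  have forward_jump: "l \<le> M" if "(w, p l) \<in> A" "l \<le> n" for l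
    using detour_no_forward_jump[OF D W(1,2)] that by (simp add: w_def)
  show ?thesis
  proof (cases "q < b - 1")
    case True
    \<comment> \<open>The new detour is to be \<open>p m'\<close>, ..., \<open>p m\<close> followed
      by \<open>W\<close>; this choice gives it length \<open>b - 1\<close>.\<close>
    define m' where "m' = m - (b - 1 - q)"
    define J where "J = {j. j < m' \<and> (w, p j) \<in> A}"
    define C where "C = (insert (p m) (set T) \<union> set W) - {w}"
    have "out_nbrs A w \<subseteq> C \<union> p ` J \<union> p ` {m'..<m}"
    proof
      fix y assume y: "y \<in> out_nbrs A w"
      then have "y \<noteq> w" using noloop by (auto simp: out_nbrs_def)
      consider "y \<in> set W" | "y \<in> set Q" | k where "y = p k" "k \<le> n"
        using y W(3) by (auto simp: w_def)
      then show "y \<in> C \<union> p ` J \<union> p ` {m'..<m}"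
      proof cases
        case 3
        then have "k \<le> M" using forward_jump[of k] y by (simp add: out_nbrs_def)
        then have "k = m \<or> k \<in> {m<..M} \<or> k \<in> {m'..<m} \<or> k < m'" by auto
        moreover have "(w, p k) \<in> A" using y 3 by (simp add: out_nbrs_def)
        ultimately show ?thesis using 3 \<open>y \<noteq> w\<close> unfolding C_def T(2) J_def by auto
      qed (use \<open>y \<noteq> w\<close> T(2) in \<open>auto simp: C_def\<close>)
    qed
    moreover have finC: "finite (C \<union> p ` J \<union> p ` {m'..<m})" by (auto simp: C_def J_def)
    ultimately have "card (out_nbrs A w) \<le> card (C \<union> p ` J \<union> p ` {m'..<m})"
      by (intro card_mono)
    also have "\<dots> \<le> card C + card (p ` J) + card (p ` {m'..<m})"
      by (meson card_Un_le add_le_mono1 le_trans)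
    also have "\<dots> \<le> card C + card J + (m - m')"
      using card_image_le[of "{m'..<m}" p] card_image_le[of J p] by (simp add: J_def)
    also have "card C \<le> b + q - 1"
    proof -
      have "w \<in> insert (p m) (set T) \<union> set W"
        using last_in_set[of "p m # W"] unfolding w_def by auto
      then have "card C = card (insert (p m) (set T) \<union> set W) - 1" by (simp add: C_def)
      moreover have "card (set (p m # T) \<union> set W) \<le> length (p m # T) + length W"
        by (metis add_mono card_Un_le card_length le_trans)
      ultimately show ?thesis using T(1) ab by (simp add: q_def)
    qed
    finally have "card (out_nbrs A w) \<le> b + q - 1 + card J + (b - 1 - q)"
      unfolding m'_def by linarith
    \<comment> \<open>Out-neighbours outside \<open>J\<close> number at most
      \<open>(b + q - 1) + (b - 1 - q) = 2 * b - 2\<close>, which leaves at least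
      \<open>a - 1\<close> for \<open>J\<close>.\<close>
    then have cJ: "a \<le> card J + 1"
      using outdeg[OF wV] ab True by simp
    then have "J \<noteq> {}" using ab by auto
    define s' where "s' = Max J"
    have "finite J" by (simp add: J_def)
    then have s': "s' \<in> J" "\<And>j. j \<in> J \<Longrightarrow> j \<le> s'"
      using \<open>J \<noteq> {}\<close> by (auto simp: s'_def)
    \<comment> \<open>By \<open>back_jump\<close>, \<open>J\<close> starts no lower than
      \<open>s + q + 2 - a\<close>; having at least \<open>a - 1\<close> elements, it must reach
      \<open>s\<close>. Thus \<open>s0\<close> remains a witness for the new detour.\<close>
    have "J \<subseteq> {s + q + 2 - a..s'}"
    proof
      fix j assume j: "j \<in> J"
      then have "s + q + 1 < a + j"
        using back_jump[of j] True ab by (cases "j \<le> s") (auto simp: J_def)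
      then show "j \<in> {s + q + 2 - a..s'}" using s'(2)[OF j] by simp
    qed
    then have "card J \<le> Suc s' - (s + q + 2 - a)"
      using card_mono[of "{s + q + 2 - a..s'}" J] by simp
    then have "s \<le> s'" using cJ ab d by simp
    \<comment> \<open>\<open>s' < m'\<close> makes \<open>m'\<close> positive, so the subtraction
      defining it was not truncated.\<close>
    have m': "m' < m" "m = m' + (b - 1 - q)" "s' < m'"
      using True s'(1) d by (auto simp: m'_def J_def)
    have "simple_path V A (seg m' (Suc m) @ W)"
    proof -
      have "simple_path V A (seg m' m @ [p m])"
        using simple_path_seg[of "Suc m" m'] m'(1) d by simp
      then have "simple_path V A (seg m' m @ p m # W)"
        using W(1,2) m'(1) d(1,2) by (auto simp: simple_path_append p_eq_iff)
      then show ?thesis using m'(1) by simp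
    qed
    moreover have "last (seg m' (Suc m) @ W) = w"
      using m'(1) by (simp add: w_def)
    moreover have "\<exists>s0\<le>s'. (p n, p s0) \<in> A \<and> i + a \<le> s0 + 2"
      using s0 \<open>s \<le> s'\<close> by (meson le_trans)
    ultimately have "detour m' m W s'"
      unfolding detour_def using d m' s'(1) W(2) True by (auto simp: J_def q_def)
    then show ?thesis using m' by blast
  next
    case False
    have "False"
    proof -
      \<comment> \<open>With \<open>p i\<close> itself excluded, the spine up to \<open>p m\<close>
        followed by \<open>W\<close> is a lollipop for \<open>Suc i\<close>.\<close>
      have "out_nbrs A w \<subseteq> p ` {i<..m} \<union> set W"
      proof
        fix y assume y: "y \<in> out_nbrs A w"
        consider "y \<in> set W" | "y \<in> set Q" | k where "y = p k" "k \<le> n"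
          using y W(3) by (auto simp: w_def)
        then show "y \<in> p ` {i<..m} \<union> set W"
        proof cases
          case 2
          then show ?thesis
            using detour_no_long_return[OF D W(1,2)] y False by (simp add: w_def q_def out_nbrs_def)
        next
          case 3
          then have y': "(w, p k) \<in> A" using y by (simp add: out_nbrs_def)
          then have "k \<le> M" using forward_jump 3 by simp
          \<comment> \<open>\<open>k - m \<le> M - m \<le> b - 1 \<le> q\<close>, so
            \<open>W\<close> is long enough to bypass the spine up to \<open>p k\<close>.\<close>
          then have "k - m \<le> length W" using d False by (simp add: q_def)
          moreover have "set W \<inter> p ` {..n} = {}" using W(2) by blast
          ultimately have "\<not> m < k"
            using no_long_bypass[OF W(1) _ _ _ _ _ s0(2,3), of k] y' 3 d s0
            by (auto simp: w_def)
          \<comment> \<open>For \<open>k \<le> i\<close>, the bounds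
            \<open>s - k \<ge> a - 2\<close> and \<open>Suc q \<ge> b \<ge> 2\<close> would violate
            \<open>back_jump\<close>.\<close>
          moreover have "i < k"
            using back_jump[OF y'] d(6) False ab by linarith
          ultimately show ?thesis using 3 by simp
        qed simp
      qed
      moreover have "set (drop (Suc i) (seg 0 (Suc m) @ W)) = p ` {i<..m} \<union> set W"
      proof -
        have "drop (Suc i) (seg 0 (Suc m) @ W) = seg (Suc i) (Suc m) @ W"
          using d ab by (simp add: drop_map del: upt_Suc)
        then show ?thesis by (auto simp del: upt_Suc)
      qed
      moreover have "last (seg 0 (Suc m) @ W) = w" by (simp add: w_def)
      moreover have "simple_path V A (seg 0 (Suc m) @ W)"
        using simple_path_seg[of "Suc m" 0] W(1,2) d
        by (subst simple_path_append) (auto simp: simple_path_Cons simp del: upt_Suc, auto)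
      ultimately have "lollipop V A (Suc i) (seg 0 (Suc m) @ W)"
        by (simp add: lollipop_def)
      then show False using max_i by fastforce
    qed
    then show ?thesis ..
  qed
qed

text \<open>The last \<open>b\<close> spine vertices form a detour with empty \<open>Q\<close>,
  returning along an arc from \<open>p n\<close> to the highest out-neighbour below them.\<close>

lemma ex_detour: "\<exists>m M Q s. detour m M Q s"
proof -
  define m where "m = Suc n - b"
  define J where "J = {j. i \<le> j \<and> j < m \<and> (p n, p j) \<in> A}"
  have "out_nbrs A (p n) \<subseteq> p ` J \<union> p ` {m..<n}"
  proof
    fix y assume y: "y \<in> out_nbrs A (p n)"
    then obtain k where k: "y = p k" "i \<le> k" "k \<le> n" using last_nbrs by auto
    then have "k \<noteq> n" using y noloop by (auto simp: out_nbrs_def)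
    then show "y \<in> p ` J \<union> p ` {m..<n}"
      using y k by (cases "k < m") (auto simp: J_def out_nbrs_def)
  qed
  then have "card (out_nbrs A (p n)) \<le> card (p ` J \<union> p ` {m..<n})"
    by (intro card_mono) (auto simp: J_def)
  also have "\<dots> \<le> card (p ` J) + card (p ` {m..<n})" by (rule card_Un_le)
  also have "\<dots> \<le> card J + (n - m)"
    using card_image_le[of "{m..<n}" p] card_image_le[of J p] by (simp add: J_def)
  \<comment> \<open>At most \<open>b - 1\<close> out-neighbours lie in \<open>{m..<n}\<close>, so
    \<open>J\<close> has at least \<open>a + b - 2\<close> elements; this pushes its maximum far
    enough above \<open>i\<close>.\<close>
  finally have cJ: "a + b \<le> card J + 2"
    using outdeg[OF pV[of n]] ab by (simp add: m_def)
  then have "J \<noteq> {}" using ab by auto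
  define s where "s = Max J"
  have "finite J" by (simp add: J_def)
  then have s: "s \<in> J" "J \<subseteq> {i..s}"
    using Max_in[of J] \<open>J \<noteq> {}\<close> by (auto simp: s_def) (simp add: J_def)
  then have "card J \<le> Suc s - i" using card_mono[of "{i..s}" J] by simp
  then have "i + a \<le> s + 2" using cJ ab s by (simp add: J_def)
  moreover have "m + b = Suc n" "s < m" using s by (auto simp: J_def m_def)
  moreover have "simple_path V A (seg m (Suc n))" by (simp add: simple_path_seg del: upt_Suc)
  moreover have "(last (seg m (Suc n)), p s) \<in> A" using s calculation ab by (simp add: J_def)
  ultimately have "detour m n [] s"
    unfolding detour_def using s ab by (auto simp: J_def simp del: upt_Suc)
  then show ?thesis by blast
qed

lemma inconsistent: False
proof -
  have "\<not> detour m M Q s" for m M Q s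
    by (induction m arbitrary: M Q s rule: less_induct) (use detour_step in blast)
  then show False using ex_detour by blast
qed

end

section \<open>Choice of the extremal path\<close>

lemma has_two_paths_if_min_outdeg:
  assumes D: "digraph V A" and deg: "min_outdeg_ge V A (a + 2 * b - 3)" and ab: "b \<le> a" "2 \<le> b"
  shows "has_two_paths V A a b"
proof (rule ccontr)
  assume no: "\<not> has_two_paths V A a b"
  have fin: "finite V" and arcs: "A \<subseteq> V \<times> V" and noloop: "(v, v) \<notin> A" for v
    using D by (auto simp: digraph_def)
  have outdeg: "a + 2 * b - 3 \<le> card (out_nbrs A v)" if "v \<in> V" for v
    using deg that by (simp add: min_outdeg_ge_def)
  \<comment> \<open>Out-degrees are positive, so \<open>drop j xs\<close> is nonempty. This bounds
    \<open>j\<close> by \<open>card V\<close> and lets a maximal \<open>i\<close> be chosen.\<close>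
  have lolli_less: "j < length xs" if "lollipop V A j xs" for j xs
  proof (rule ccontr)
    assume "\<not> j < length xs"
    then have "out_nbrs A (last xs) = {}" using that by (simp add: lollipop_def)
    moreover have "last xs \<in> V" using that by (auto simp: lollipop_def simple_path_def)
    ultimately show False using outdeg[of "last xs"] ab by simp
  qed
  have len: "length xs \<le> card V" if "lollipop V A j xs" for j xs
    using that length_simple_path_le[OF fin] by (auto simp: lollipop_def)
  obtain v where "v \<in> V" using D by (auto simp: digraph_def)
  then have "simple_path V A [v]" by (simp add: simple_path_Cons)
  then obtain W where "simple_path V A ([v] @ W)" "out_nbrs A (last ([v] @ W)) \<subseteq> set ([v] @ W) \<union> {}"
    by (rule maximal_extension[OF fin arcs]) auto
  then have "\<exists>xs. lollipop V A 0 xs" by (auto simp: lollipop_def intro!: exI[of _ "[v] @ W"])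
  moreover have "\<forall>j. (\<exists>xs. lollipop V A j xs) \<longrightarrow> j < Suc (card V)"
    using lolli_less len by (meson le_SucI less_le_trans)
  ultimately obtain i where i: "\<exists>xs. lollipop V A i xs" and max_i: "\<And>j xs. lollipop V A j xs \<Longrightarrow> j \<le> i"
    using ex_has_greatest_nat[of "\<lambda>j. \<exists>xs. lollipop V A j xs" 0 "\<lambda>j. j" "Suc (card V)"] by blast
  then obtain ys where "lollipop V A i ys" by blast
  moreover have "\<forall>xs. lollipop V A i xs \<longrightarrow> length xs < Suc (card V)"
    using len by (auto simp: less_Suc_eq_le)
  ultimately obtain xs where xs: "lollipop V A i xs"
    and max_n: "\<And>zs. lollipop V A i zs \<Longrightarrow> length zs \<le> length xs"
    using ex_has_greatest_nat[of "lollipop V A i" ys length "Suc (card V)"] by blast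
  define n where "n = length xs - 1"
  have path: "distinct xs" "set xs \<subseteq> V" "successively (\<lambda>u v. (u, v) \<in> A) xs"
    and xs0: "xs \<noteq> []" and nbrs: "out_nbrs A (last xs) \<subseteq> set (drop i xs)"
    using xs by (auto simp: lollipop_def simple_path_def)
  have n: "length xs = Suc n" using xs0 by (simp add: n_def)
  have last: "last xs = xs ! n" using xs0 by (simp add: n_def last_conv_nth)
  have i_le: "i \<le> n" using lolli_less[OF xs] n by simp
  \<comment> \<open>Otherwise the same path would be a lollipop for \<open>Suc i\<close>.\<close>
  have "xs ! i \<in> out_nbrs A (last xs)"
  proof (rule ccontr)
    assume "xs ! i \<notin> out_nbrs A (last xs)"
    moreover have "drop i xs = xs ! i # drop (Suc i) xs" using i_le n by (simp add: Cons_nth_drop_Suc)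
    ultimately have "out_nbrs A (last xs) \<subseteq> set (drop (Suc i) xs)" using nbrs by auto
    then have "lollipop V A (Suc i) xs" using xs by (simp add: lollipop_def)
    then show False using max_i by fastforce
  qed
  then have back_arc: "(xs ! n, xs ! i) \<in> A" by (simp add: last out_nbrs_def)
  have "set (drop i xs) \<subseteq> (!) xs ` {i..n}"
  proof
    fix y assume "y \<in> set (drop i xs)"
    then obtain k where "k < length xs - i" "y = xs ! (i + k)" by (auto simp: in_set_conv_nth)
    then show "y \<in> (!) xs ` {i..n}" using n by (intro image_eqI[of _ _ "i + k"]) auto
  qed
  then have last_nbrs: "out_nbrs A (xs ! n) \<subseteq> (!) xs ` {i..n}" using nbrs last by auto
  interpret extremal_lollipop V A a b "(!) xs" n i
  proof
    show "inj_on ((!) xs) {..n}" using path(1) n by (auto simp: inj_on_def nth_eq_iff_index_eq)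
    show "xs ! k \<in> V" if "k \<le> n" for k using that n path(2) by (auto intro: nth_mem)
    show "(xs ! k, xs ! Suc k) \<in> A" if "k < n" for k
      using that n path(3) by (auto simp: successively_conv_nth)
  qed (use fin arcs noloop ab outdeg i_le back_arc last_nbrs max_i max_n n no in auto)
  show False by (rule inconsistent)
qed

section \<open>Subdivisions of two-block cycles\<close>

text \<open>Both blocks of the cycle have this shape, with \<open>c = 2\<close>,
  \<open>m = k1 - 1\<close> and with \<open>c = Suc k1\<close>, \<open>m = k2 - 1\<close>.\<close>

lemma chain_arcs:
  assumes "(u, v) \<in> set (zip ([0] @ [c..<c + m] @ [1]) (tl ([0] @ [c..<c + m] @ [1])))" "0 < m"
  shows "u = 0 \<and> v = c \<or> u = c + m - 1 \<and> v = 1 \<or> c \<le> u \<and> v = Suc u \<and> v < c + m"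
  using assms by (auto simp: set_zip nth_append nth_Cons split: if_splits nat.splits)

lemma contains_subdivision_if_two_paths:
  assumes "has_two_paths V A k1 k2" and k: "2 \<le> k1" "2 \<le> k2"
  shows "contains_subdivision V A (C_verts k1 k2) (C_arcs k1 k2)"
proof -
  obtain x y X Y where X: "simple_path V A (x # X @ [y])" and Y: "simple_path V A (x # Y @ [y])"
    and XY: "set X \<inter> set Y = {}" and len: "k1 \<le> Suc (length X)" "k2 \<le> Suc (length Y)"
    using assms by (auto simp: has_two_paths_def)
  \<comment> \<open>The surplus length of both paths is put on their last arcs, those into vertex 1.\<close>
  define f where "f v = (if v = 0 then x else if v = 1 then y else if v \<le> k1 then X ! (v - 2)
    else Y ! (v - Suc k1))" for v
  \<comment> \<open>\<open>drop (k1 - 2) X\<close> starts at \<open>f k1\<close>; the last branch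
    serves the arc from \<open>k1 + k2 - 1\<close> to \<open>1\<close>.\<close>
  define P where "P e = (if snd e \<noteq> 1 then [f (fst e), f (snd e)]
    else if fst e = k1 then drop (k1 - 2) X @ [y] else drop (k2 - 2) Y @ [y])" for e
  \<comment> \<open>\<open>f\<close> maps \<open>2\<close>, ..., \<open>k1\<close> to the first
    \<open>k1 - 1\<close> vertices of \<open>X\<close>, and similarly for \<open>Y\<close>;
    \<open>I1\<close> and \<open>I2\<close> are the surplus vertices.\<close>
  define I1 where "I1 = set (drop (k1 - 1) X)"
  define I2 where "I2 = set (drop (k2 - 1) Y)"
  have verts: "C_verts k1 k2 = {..<k1 + k2}"
    using k by (auto simp: C_verts_def Cpath1_def Cpath2_def)
  have arcs: "(u = 0 \<and> v = 2 \<or> u = k1 \<and> v = 1 \<or> 2 \<le> u \<and> v = Suc u \<and> v \<le> k1) \<or>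
     (u = 0 \<and> v = Suc k1 \<or> u = k1 + k2 - 1 \<and> v = 1 \<or> Suc k1 \<le> u \<and> v = Suc u \<and> v < k1 + k2)"
    if "(u, v) \<in> C_arcs k1 k2" for u v
    using that chain_arcs[of u v 2 "k1 - 1"] chain_arcs[of u v "Suc k1" "k2 - 1"] k
    by (auto simp: C_arcs_def Cpath1_def Cpath2_def simp del: upt_Suc)
  have dist: "distinct X" "distinct Y" "x \<notin> set X" "y \<notin> set X" "x \<notin> set Y" "y \<notin> set Y" "x \<noteq> y"
    and inV: "x \<in> V" "y \<in> V" "set X \<subseteq> V" "set Y \<subseteq> V"
    using X Y by (auto simp: simple_path_def)
  have fX: "f v = X ! (v - 2)" "v - 2 < length X" "f v \<in> set X" if "2 \<le> v" "v \<le> k1" for v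
    using that len by (auto simp: f_def intro!: nth_mem)
  have fY: "f v = Y ! (v - Suc k1)" "v - Suc k1 < length Y" "f v \<in> set Y" if "Suc k1 \<le> v" "v < k1 + k2" for v
    using that len k by (auto simp: f_def intro!: nth_mem)
  have f01: "f 0 = x" "f (Suc 0) = y" by (simp_all add: f_def)
  have cases: "v = 0 \<or> v = 1 \<or> (2 \<le> v \<and> v \<le> k1) \<or> (Suc k1 \<le> v \<and> v < k1 + k2)" if "v < k1 + k2" for v
    using that by linarith
  have XY_nth: "X ! s \<noteq> Y ! t" "Y ! t \<noteq> X ! s" if "s < length X" "t < length Y" for s t
    using XY that by (metis disjoint_iff nth_mem)+
  have inj: "inj_on f {..<k1 + k2}"
  proof (rule inj_onI)
    fix u v assume uv: "u \<in> {..<k1 + k2}" "v \<in> {..<k1 + k2}" "f u = f v"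
    then show "u = v"
      using cases[of u] cases[of v] fX[of u] fX[of v] fY[of u] fY[of v] f01 dist XY_nth
      by (auto simp: nth_eq_iff_index_eq)
  qed
  have I1: "I1 \<inter> f ` {..<k1 + k2} = {}" "I1 \<subseteq> set X"
  proof -
    have "f v \<notin> I1" if "v < k1 + k2" for v
    proof
      assume a: "f v \<in> I1"
      then obtain t where "t < length X - (k1 - 1)" "f v = X ! (k1 - 1 + t)"
        by (auto simp: I1_def in_set_conv_nth)
      then show False
        using cases[OF that] fX[of v] fY[of v] f01 dist XY_nth k by (auto simp: nth_eq_iff_index_eq)
    qed
    then show "I1 \<inter> f ` {..<k1 + k2} = {}" by auto
  qed (simp add: I1_def set_drop_subset)
  have I2: "I2 \<inter> f ` {..<k1 + k2} = {}" "I2 \<subseteq> set Y"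
  proof -
    have "f v \<notin> I2" if "v < k1 + k2" for v
    proof
      assume a: "f v \<in> I2"
      then obtain t where "t < length Y - (k2 - 1)" "f v = Y ! (k2 - 1 + t)"
        by (auto simp: I2_def in_set_conv_nth)
      then show False
        using cases[OF that] fX[of v] fY[of v] f01 dist XY_nth k by (auto simp: nth_eq_iff_index_eq)
    qed
    then show "I2 \<inter> f ` {..<k1 + k2} = {}" by auto
  qed (simp add: I2_def set_drop_subset)
  have tail1: "drop (k1 - 2) X = f k1 # drop (k1 - 1) X"
    using fX[of k1] k by (simp add: Cons_nth_drop_Suc[symmetric] Suc_diff_le numeral_2_eq_2 Suc_diff_Suc)
  have tail2: "drop (k2 - 2) Y = f (k1 + k2 - 1) # drop (k2 - 1) Y"
    using fY[of "k1 + k2 - 1"] k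
    by (simp add: Cons_nth_drop_Suc[symmetric] Suc_diff_le numeral_2_eq_2 Suc_diff_Suc)
  have "simple_path V A ((x # take j X) @ drop j X @ [y])" "simple_path V A ((x # take j Y) @ drop j Y @ [y])" for j
    using X Y by (simp_all add: append.assoc[symmetric] del: append.assoc append_assoc)
  then have tails: "simple_path V A (drop j X @ [y])" "simple_path V A (drop j Y @ [y])" for j
    by (subst (asm) (1 2) simple_path_append; blast)+
  have A1: "(x, X ! 0) \<in> A" "Suc t < length X \<Longrightarrow> (X ! t, X ! Suc t) \<in> A" if "X \<noteq> []" for t
    using X that by (auto simp: simple_path_def successively_Cons successively_append_iff hd_conv_nth nth_append
      successively_conv_nth[of _ X])
  have A2: "(x, Y ! 0) \<in> A" "Suc t < length Y \<Longrightarrow> (Y ! t, Y ! Suc t) \<in> A" if "Y \<noteq> []" for t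
    using Y that by (auto simp: simple_path_def successively_Cons successively_append_iff hd_conv_nth nth_append
      successively_conv_nth[of _ Y])
  have ne: "X \<noteq> []" "Y \<noteq> []" using len k by auto
  have fA: "(f u, f v) \<in> A" "u < k1 + k2" "v < k1 + k2" "u \<noteq> v"
    if uv: "(u, v) \<in> C_arcs k1 k2" "v \<noteq> 1" for u v
  proof -
    show "u < k1 + k2" "v < k1 + k2" "u \<noteq> v" using arcs[OF uv(1)] uv(2) k by auto
    consider "u = 0" "v = 2" | "2 \<le> u" "v = Suc u" "v \<le> k1" | "u = 0" "v = Suc k1"
      | "Suc k1 \<le> u" "v = Suc u" "v < k1 + k2"
      using arcs[OF uv(1)] uv(2) by blast
    then show "(f u, f v) \<in> A"
    proof cases
      case 2
      then obtain t where "u = 2 + t" by (meson le_Suc_ex)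
      then show ?thesis using 2 fX[of u] fX[of v] A1(2)[OF ne(1), of t] by simp
    next
      case 4
      then obtain t where "u = Suc k1 + t" by (meson le_Suc_ex)
      then show ?thesis using 4 fY[of u] fY[of v] A2(2)[OF ne(2), of t] by simp
    qed (use fX[of 2] fY[of "Suc k1"] f01 A1(1)[OF ne(1)] A2(1)[OF ne(2)] k in auto)
  qed
  have fV: "f v \<in> V" if "v < k1 + k2" for v
    using cases[OF that] fX(3)[of v] fY(3)[of v] f01 inV by auto
  have end_arcs: "u = k1 \<or> u = k1 + k2 - 1" if "(u, 1) \<in> C_arcs k1 k2" for u
    using arcs[OF that] k by auto
  \<comment> \<open>As \<open>k2 \<ge> 2\<close>, the two arcs into \<open>1\<close> have different
    tails, so the case split in \<open>P\<close> separates them.\<close>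
  have last_ne: "k1 + k2 - 1 \<noteq> k1" using k by simp
  have dip: "dipath V A (f u) (f v) (P (u, v))" if "(u, v) \<in> C_arcs k1 k2" for u v
  proof (cases "v = 1")
    case True
    then show ?thesis
      using end_arcs[of u] that tails[of "k1 - 2"] tails[of "k2 - 2"] last_ne
      by (intro simple_path_imp_dipath) (auto simp: P_def tail1 tail2 f01)
  next
    case False
    then show ?thesis
      using fA[OF that] fV inj
      by (intro simple_path_imp_dipath) (auto simp: P_def simple_path_Cons inj_on_def)
  qed
  have inner: "inner (P (u, v)) = (if v \<noteq> 1 then {} else if u = k1 then I1 else I2)"
    if "(u, v) \<in> C_arcs k1 k2" for u v
    using end_arcs[of u] that by (auto simp: inner_def P_def tail1 tail2 I1_def I2_def butlast_append)
  have inner_f: "inner (P (u, v)) \<inter> f ` {..<k1 + k2} = {}" if "(u, v) \<in> C_arcs k1 k2" for u v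
    using inner[OF that] I1(1) I2(1) by simp
  \<comment> \<open>This reduces disjointness of an interior from another path to disjointness from
    the branch vertices and from the other interior.\<close>
  have setP: "set (P (u, v)) \<subseteq> f ` {..<k1 + k2} \<union> inner (P (u, v))" if "(u, v) \<in> C_arcs k1 k2" for u v
  proof (cases "v = 1")
    case True
    have "f k1 \<in> f ` {..<k1 + k2}" "f (k1 + k2 - 1) \<in> f ` {..<k1 + k2}" "y \<in> f ` {..<k1 + k2}"
      using k f01(2) by (auto intro!: image_eqI[of y f 1])
    then show ?thesis
      using end_arcs[of u] that True inner[OF that] last_ne
      by (auto simp: P_def tail1 tail2 I1_def I2_def)
  next
    case False
    then show ?thesis using fA[OF that] by (auto simp: P_def)
  qed
  show ?thesis
    unfolding contains_subdivision_def verts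
  proof (intro exI[of _ f] exI[of _ P] conjI ballI impI)
    show "inj_on f {..<k1 + k2}" by (rule inj)
    show "f ` {..<k1 + k2} \<subseteq> V" using fV by auto
    show "case e of (u, v) \<Rightarrow> dipath V A (f u) (f v) (P (u, v)) \<and> inner (P (u, v)) \<inter> f ` {..<k1 + k2} = {}"
      if "e \<in> C_arcs k1 k2" for e
      using that dip inner_f by (cases e) simp
    show "inner (P e) \<inter> set (P e') = {}"
      if e: "e \<in> C_arcs k1 k2" "e' \<in> C_arcs k1 k2" "e \<noteq> e'" for e e'
    proof -
      obtain u v u' v' where uv: "e = (u, v)" "e' = (u', v')" by (cases e, cases e')
      have "inner (P e) \<inter> f ` {..<k1 + k2} = {}"
        using e uv inner_f by simp
      moreover have "inner (P e) \<inter> inner (P e') = {}"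
        using e uv inner[of u v] inner[of u' v'] I1(2) I2(2) XY end_arcs[of u] end_arcs[of u'] last_ne
        by auto
      ultimately show ?thesis using setP[of u' v'] e uv by blast
    qed
  qed
qed

theorem theorem1p8:
  fixes k1 k2 :: nat and V :: "'a set" and A :: "('a \<times> 'a) set"
  assumes "k1 \<ge> k2" and "k2 \<ge> 2"
    and "digraph V A"
    and "min_outdeg_ge V A (k1 + 3 * k2 - 5)"
  shows "contains_subdivision V A (C_verts k1 k2) (C_arcs k1 k2)"
proof -
  have "min_outdeg_ge V A (k1 + 2 * k2 - 3)"
    using assms(2,4) by (force simp: min_outdeg_ge_def)
  then show ?thesis
    using has_two_paths_if_min_outdeg contains_subdivision_if_two_paths assms by (metis le_trans)
qed

end
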